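(* Let $\mathbf{X}=(X_n)_{n\in\mathbb{Z}}$ and $\mathbf{Y}=(Y_n)_{n\in\mathbb{Z}}$ be two stationary chains of infinite order on $\mathcal{A}=\{0,1\}$ with transition probabilities $p^X$ and $p^Y$ such that: $p^X(1\mid x_{-\infty}^{-1})\le p^Y(1\mid y_{-\infty}^{-1})$ whenever $x_{-\infty}^{-1}\le y_{-\infty}^{-1}$ (ordering); $\max\{\beta^X(k),\beta^Y(k)\}\to0$ as $k\to\infty$, where $\beta^X(k)=\max_{a\in\mathcal{A}}\sup\{|p^X(a\mid x_{-\infty}^{-1})-p^X(a\mid y_{-\infty}^{-1})|: x_{-k}^{-1}=y_{-k}^{-1}\}$ and similarly for $\beta^Y$ (continuity); and $\prod_{k\ge0}\alpha_k>0$, where the numbers $\alpha_k$ are defined from $p^X$ and $p^Y$ as in the context. Let $P$ be the coupled kernel on $\mathcal{S}\times\mathcal{S}_{-\infty}^{-1}$ and $(\lambda_k)_{k\in\mathbb{N}}$ the probability distribution defined in the context. Then there exist a sequence of transition probabilities $P_k$ on $\mathcal{S}\times\mathcal{S}_{-k}^{-1}$, $k\ge1$, and a probability measure $P_0$ on $\mathcal{S}$ such that for any pair of symbols $(a,b)\in\mathcal{S}$ and any ordered pair of pasts $(x_{-\infty}^{-1},y_{-\infty}^{-1})\in\mathcal{S}_{-\infty}^{-1}$, $$P\left((a,b)\mid(x_{-\infty}^{-1},y_{-\infty}^{-1})\right)=\lambda_0P_0((a,b))+\sum_{k=1}^{\infty}\lambda_kP_k\left((a,b)\mid(x_{-k}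^{-1},y_{-k}^{-1})\right).$$
   Context: **Chains.** For integers $m\le n$, $x_m^n=(x_m,\dots,x_n)$; $x_{-\infty}^{-1}=(x_i)_{i\le -1}$ is called a past, and $\mathcal{A}_{-\infty}^{-1}$ is the set of pasts. $\mathbb{N}=\{0,1,2,\dots\}$. That $\mathbf{X}$ is a stationary chain of infinite order with transition probabilities $p^X$ means that $\mathbf X$ is stationary and $p^X(a\mid x_{-\infty}^{-1})$ is a (regular) version of $\mathbb{P}(X_0=a\mid X_{-\infty}^{-1}=x_{-\infty}^{-1})$, defined for every past and every $a\in\mathcal{A}$; similarly for $\mathbf{Y}$ and $p^Y$. Write $x_{-\infty}^{-1}\le y_{-\infty}^{-1}$ if $x_n\le y_n$ for all $n\le -1$. **Coupled kernel.** Let $\mathcal{S}=\{(0,0),(0,1),(1,1)\}$; $\mathcal{S}_{-\infty}^{-1}$ (resp. $\mathcal{S}_{-k}^{-1}$) is the set of $\mathcal S$-valued sequences indexed by $i\le-1$ (resp. $-k\le i\le -1$), identified with ordered pairs of pasts (resp. strings) $(x,y)$. For $(x_{-\infty}^{-1},y_{-\infty}^{-1})\in\mathcal{S}_{-\infty}^{-1}$ define $P((1,1)\mid(x_{-\infty}^{-1},y_{-\infty}^{-1}))=p^X(1\mid x_{-\infty}^{-1})$, $P((0,0)\mid(x_{-\infty}^{-1},y_{-\infty}^{-1}))=p^Y(0\mid y_{-\infty}^{-1})$, $P((0,1)\mid(x_{-\infty}^{-1},y_{-\infty}^{-1}))=p^X(0\mid x_{-\infty}^{-1})-p^Y(0\mid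 y_{-\infty}^{-1})$. For $(a,b)\in\mathcal{S}$ put $r_0((a,b))=\inf\{P((a,b)\mid w): w\in\mathcal{S}_{-\infty}^{-1}\}$, and for $k\ge1$, $r_k((a,b)\mid(x_{-k}^{-1},y_{-k}^{-1}))=\inf\{P((a,b)\mid(u_{-\infty}^{-1},v_{-\infty}^{-1})):(u_{-\infty}^{-1},v_{-\infty}^{-1})\in\mathcal{S}_{-\infty}^{-1},\,u_{-k}^{-1}=x_{-k}^{-1},\,v_{-k}^{-1}=y_{-k}^{-1}\}$. Put $\alpha_0=\sum_{(a,b)\in\mathcal{S}}r_0((a,b))$ and, for $k\ge1$, $\alpha_k=\inf\{\sum_{(a,b)\in\mathcal{S}}r_k((a,b)\mid(x_{-k}^{-1},y_{-k}^{-1})):(x_{-k}^{-1},y_{-k}^{-1})\in\mathcal{S}_{-k}^{-1}\}$. **Weights.** $\lambda_0=\alpha_0$ and $\lambda_k=\alpha_k-\alpha_{k-1}$ for $k\ge1$; since $\max\{\beta^X(k),\beta^Y(k)\}\to0$, $\alpha_k\to1$ and $(\lambda_k)_{k\in\mathbb{N}}$ is a probability distribution. A transition probability $P_k$ on $\mathcal{S}\times\mathcal{S}_{-k}^{-1}$ is a function $P_k(\cdot\mid\cdot):\mathcal{S}\times\mathcal{S}_{-k}^{-1}\to[0,1]$ such that $P_k(\cdot\mid w)$ is a probability measure on $\mathcal{S}$ for each $w\in\mathcal{S}_{-k}^{-1}$. *)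

theory Defs
  imports "HOL-Probability.Probability"
begin

text \<open>
  Sequences are extensional functions on their index set: a past lives on all indices
  \<open>i \<le> -1\<close>, a string of length \<open>k\<close> on \<open>-k \<le> i \<le> -1\<close>. A transition probability
  \<open>p(a | x)\<close> is written \<open>p a x\<close>. Its values at arguments outside the alphabet, or at
  functions that are not pasts (or strings), are irrelevant.
\<close>

definition alphabet :: "nat set" where
  "alphabet = {0, 1}"

definition pasts :: "(int \<Rightarrow> nat) set" where
  "pasts = {..-1} \<rightarrow>\<^sub>E alphabet"

definition strings :: "nat \<Rightarrow> (int \<Rightarrow> nat) set" where
  "strings k = {- int k..-1} \<rightarrow>\<^sub>E alphabet"

definition window :: "nat \<Rightarrow> (int \<Rightarrow> nat) \<Rightarrow> (int \<Rightarrow> nat)" where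
  "window k x = restrict x {- int k..-1}"

definition past_le :: "(int \<Rightarrow> nat) \<Rightarrow> (int \<Rightarrow> nat) \<Rightarrow> bool" where
  "past_le x y \<longleftrightarrow> (\<forall>n\<le>-1. x n \<le> y n)"

definition prob_vector :: "'s set \<Rightarrow> ('s \<Rightarrow> real) \<Rightarrow> bool" where
  "prob_vector S q \<longleftrightarrow> (\<forall>s\<in>S. 0 \<le> q s \<and> q s \<le> 1) \<and> (\<Sum>s\<in>S. q s) = 1"

definition past_space :: "(int \<Rightarrow> nat) measure" where
  "past_space = (\<Pi>\<^sub>M i\<in>{..-1}. count_space alphabet)"

definition past_of :: "(int \<Rightarrow> 'w \<Rightarrow> nat) \<Rightarrow> 'w \<Rightarrow> (int \<Rightarrow> nat)" where
  "past_of X \<omega> = (\<lambda>i\<in>{..-1}. X i \<omega>)"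

definition stationary_process :: "'w measure \<Rightarrow> (int \<Rightarrow> 'w \<Rightarrow> nat) \<Rightarrow> bool" where
  "stationary_process M X \<longleftrightarrow>
     prob_space M \<and>
     (\<forall>n. X n \<in> M \<rightarrow>\<^sub>M count_space alphabet) \<and>
     (\<forall>m. distr M (\<Pi>\<^sub>M n\<in>UNIV. count_space alphabet) (\<lambda>\<omega> n. X (n + m) \<omega>)
        = distr M (\<Pi>\<^sub>M n\<in>UNIV. count_space alphabet) (\<lambda>\<omega> n. X n \<omega>))"

text \<open>
  The last conjunct says that \<open>p a (X_{-\<infinity>}^{-1})\<close> is a version of the conditional
  probability of \<open>X_0 = a\<close> given the sigma-algebra generated by the past; the kernel
  conditions before it hold at every past, not just almost everywhere.
\<close>

definition chain_of_infinite_order ::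
    "'w measure \<Rightarrow> (int \<Rightarrow> 'w \<Rightarrow> nat) \<Rightarrow> (nat \<Rightarrow> (int \<Rightarrow> nat) \<Rightarrow> real) \<Rightarrow> bool" where
  "chain_of_infinite_order M X p \<longleftrightarrow>
     stationary_process M X \<and>
     (\<forall>x\<in>pasts. prob_vector alphabet (\<lambda>a. p a x)) \<and>
     (\<forall>a\<in>alphabet. p a \<in> borel_measurable past_space) \<and>
     (\<forall>a\<in>alphabet. AE \<omega> in M.
        real_cond_exp M (vimage_algebra (space M) (past_of X) past_space)
          (indicator {\<omega> \<in> space M. X 0 \<omega> = a}) \<omega>
        = p a (past_of X \<omega>))"

definition beta :: "(nat \<Rightarrow> (int \<Rightarrow> nat) \<Rightarrow> real) \<Rightarrow> nat \<Rightarrow> real" where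
  "beta p k = (MAX a\<in>alphabet.
     Sup {\<bar>p a x - p a y\<bar> | x y. x \<in> pasts \<and> y \<in> pasts \<and> window k x = window k y})"

definition pair_alphabet :: "(nat \<times> nat) set" where
  "pair_alphabet = {(0, 0), (0, 1), (1, 1)}"

definition pair_pasts :: "((int \<Rightarrow> nat) \<times> (int \<Rightarrow> nat)) set" where
  "pair_pasts = {(x, y). x \<in> pasts \<and> y \<in> pasts \<and> (\<forall>i\<le>-1. (x i, y i) \<in> pair_alphabet)}"

definition pair_strings :: "nat \<Rightarrow> ((int \<Rightarrow> nat) \<times> (int \<Rightarrow> nat)) set" where
  "pair_strings k = {(x, y). x \<in> strings k \<and> y \<in> strings k \<and>
     (\<forall>i\<in>{- int k..-1}. (x i, y i) \<in> pair_alphabet)}"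

text \<open>The final \<open>else\<close> branch below lies outside \<open>pair_alphabet\<close>.\<close>

definition coupled_kernel ::
    "(nat \<Rightarrow> (int \<Rightarrow> nat) \<Rightarrow> real) \<Rightarrow> (nat \<Rightarrow> (int \<Rightarrow> nat) \<Rightarrow> real)
      \<Rightarrow> nat \<times> nat \<Rightarrow> (int \<Rightarrow> nat) \<times> (int \<Rightarrow> nat) \<Rightarrow> real" where
  "coupled_kernel pX pY s = (\<lambda>(x, y).
     if s = (1, 1) then pX 1 x
     else if s = (0, 0) then pY 0 y
     else if s = (0, 1) then pX 0 x - pY 0 y
     else 0)"

text \<open>
  In the next three definitions \<open>P\<close> is a function of a pair of symbols and a pair of
  pasts; they are applied to the coupled kernel.
\<close>

definition r_zero :: "(nat \<times> nat \<Rightarrow> (int \<Rightarrow> nat) \<times> (int \<Rightarrow> nat) \<Rightarrow> real)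
    \<Rightarrow> nat \<times> nat \<Rightarrow> real" where
  "r_zero P s = Inf {P s w | w. w \<in> pair_pasts}"

definition r_string :: "(nat \<times> nat \<Rightarrow> (int \<Rightarrow> nat) \<times> (int \<Rightarrow> nat) \<Rightarrow> real)
    \<Rightarrow> nat \<Rightarrow> nat \<times> nat \<Rightarrow> (int \<Rightarrow> nat) \<times> (int \<Rightarrow> nat) \<Rightarrow> real" where
  "r_string P k s = (\<lambda>(x, y).
     Inf {P s (u, v) | u v. (u, v) \<in> pair_pasts \<and> window k u = x \<and> window k v = y})"

definition alpha :: "(nat \<times> nat \<Rightarrow> (int \<Rightarrow> nat) \<times> (int \<Rightarrow> nat) \<Rightarrow> real) \<Rightarrow> nat \<Rightarrow> real" where
  "alpha P k =
     (if k = 0 then \<Sum>s\<in>pair_alphabet. r_zero P s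
      else Inf {\<Sum>s\<in>pair_alphabet. r_string P k s w | w. w \<in> pair_strings k})"

definition weight :: "(nat \<times> nat \<Rightarrow> (int \<Rightarrow> nat) \<times> (int \<Rightarrow> nat) \<Rightarrow> real) \<Rightarrow> nat \<Rightarrow> real" where
  "weight P k = (if k = 0 then alpha P 0 else alpha P k - alpha P (k - 1))"

definition pair_transition_probability ::
    "nat \<Rightarrow> (nat \<times> nat \<Rightarrow> (int \<Rightarrow> nat) \<times> (int \<Rightarrow> nat) \<Rightarrow> real) \<Rightarrow> bool" where
  "pair_transition_probability k Q \<longleftrightarrow>
     (\<forall>w\<in>pair_strings k. prob_vector pair_alphabet (\<lambda>s. Q s w))"

end

theory Submission
  imports Defs
begin

text \<open>
  For any kernel \<open>P\<close> on pair pasts the infima \<open>r_k(s | w_k)\<close> increase in \<open>k\<close>, and their totals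
  satisfy \<open>\<alpha>_k \<le> \<Sum>\<^sub>s r_k(s | w_k)\<close>. Instead of partitioning the unit interval, one builds
  masses \<open>F_k(s | w_k) \<le> r_k(s | w_k)\<close> of total \<open>\<alpha>_k\<close>: the step from \<open>F_k\<close> to \<open>F_{k+1}\<close> moves towards
  \<open>r_{k+1}\<close> along a straight line, just far enough to gain the total mass \<open>\<lambda>_{k+1}\<close>. The normalized
  direction of the step is \<open>P_{k+1}\<close>. As \<open>F_k \<le> P\<close> and the defect \<open>P - F_k\<close> has total
  \<open>1 - \<alpha>_k \<rightarrow> 0\<close>, the series telescopes to \<open>P\<close>.
\<close>

section \<open>Windows of pairs of pasts\<close>

definition windows :: "nat \<Rightarrow> (int \<Rightarrow> nat) \<times> (int \<Rightarrow> nat) \<Rightarrow> (int \<Rightarrow> nat) \<times> (int \<Rightarrow> nat)" where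
  "windows k = map_prod (window k) (window k)"

lemma window_window: "k \<le> m \<Longrightarrow> window k (window m x) = window k x"
  by (auto simp: window_def restrict_def fun_eq_iff)

lemma windows_windows: "k \<le> m \<Longrightarrow> windows k (windows m w) = windows k w"
  by (cases w) (simp add: windows_def window_window)

text \<open>For k = 0 the index range from 0 to -1 is empty, so all windows coincide. This lets r_0
  be handled as the level k = 0 of the r_k.\<close>

lemma windows_0: "windows 0 w = windows 0 v"
  by (cases w; cases v) (simp add: windows_def window_def restrict_def)

lemma windows_in_pair_strings: "w \<in> pair_pasts \<Longrightarrow> windows k w \<in> pair_strings k"
  by (auto simp: windows_def window_def pair_pasts_def pair_strings_def pasts_def strings_def
        PiE_def Pi_def)

lemma pair_string_extends:
  assumes "w \<in> pair_strings k"
  obtains v where "v \<in> pair_pasts" "windows k v = w"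
proof -
  obtain x y where w: "w = (x, y)" by (cases w)
  \<comment> \<open>Zeros are put on all indices below -k. This adds only the symbol (0, 0), so the
    extended pair stays ordered.\<close>
  define ext where "ext = (\<lambda>z::int \<Rightarrow> nat. \<lambda>i\<in>{..-1}. if - int k \<le> i then z i else 0)"
  have in_pasts: "ext z \<in> pasts" if "z \<in> strings k" for z
    using that by (auto simp: ext_def pasts_def strings_def alphabet_def PiE_def Pi_def)
  have win: "window k (ext z) = z" if "z \<in> strings k" for z
    using that by (fastforce simp: ext_def window_def strings_def PiE_def extensional_def fun_eq_iff)
  have "(ext x, ext y) \<in> pair_pasts"
    using assms in_pasts[of x] in_pasts[of y]
    by (auto simp: w pair_pasts_def pair_strings_def ext_def pair_alphabet_def)
  moreover have "windows k (ext x, ext y) = w"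
    using assms by (simp add: w windows_def win pair_strings_def)
  ultimately show thesis by (rule that)
qed

lemma pair_pasts_nonempty: "pair_pasts \<noteq> {}"
proof -
  have "((\<lambda>i\<in>{..-1}. 0), (\<lambda>i\<in>{..-1}. 0)) \<in> pair_pasts"
    by (auto simp: pair_pasts_def pasts_def alphabet_def pair_alphabet_def)
  then show ?thesis by blast
qed

lemma finite_pair_alphabet [simp]: "finite pair_alphabet"
  by (simp add: pair_alphabet_def)

lemma sum_pair_alphabet:
  "(\<Sum>s\<in>pair_alphabet. f s) = f (0, 0) + f (0, 1) + (f (1, 1) :: real)"
  by (simp add: pair_alphabet_def)

text \<open>The upper bound 1 comes for free: a nonnegative entry is at most the total.\<close>

lemma prob_vector_pair_alphabetI:
  assumes "\<And>s. s \<in> pair_alphabet \<Longrightarrow> 0 \<le> q s" "(\<Sum>s\<in>pair_alphabet. q s) = 1"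
  shows "prob_vector pair_alphabet q"
  using assms member_le_sum[of _ pair_alphabet q] by (fastforce simp: prob_vector_def)

section \<open>The infima r_k and their totals\<close>

locale pair_kernel =
  fixes P :: "nat \<times> nat \<Rightarrow> (int \<Rightarrow> nat) \<times> (int \<Rightarrow> nat) \<Rightarrow> real"
  assumes prob: "w \<in> pair_pasts \<Longrightarrow> prob_vector pair_alphabet (\<lambda>s. P s w)"
begin

text \<open>Evaluating r_k at pasts instead of strings gives all levels the same argument, so they
  can be compared pointwise.\<close>

definition r_window :: "nat \<Rightarrow> nat \<times> nat \<Rightarrow> (int \<Rightarrow> nat) \<times> (int \<Rightarrow> nat) \<Rightarrow> real" where
  "r_window k s w = r_string P k s (windows k w)"

lemma nonneg: "w \<in> pair_pasts \<Longrightarrow> s \<in> pair_alphabet \<Longrightarrow> 0 \<le> P s w"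
  using prob by (auto simp: prob_vector_def)

lemma r_window_eq_Inf:
  "r_window k s w = Inf {P s v | v. v \<in> pair_pasts \<and> windows k v = windows k w}"
  unfolding r_window_def r_string_def windows_def
  by (cases w) (auto intro!: arg_cong[where f = Inf])

lemma r_window_windows: "k \<le> m \<Longrightarrow> r_window k s (windows m w) = r_window k s w"
  by (simp add: r_window_def windows_windows)

lemma r_window_le:
  assumes "v \<in> pair_pasts" "windows k v = windows k w" "s \<in> pair_alphabet"
  shows "r_window k s w \<le> P s v"
  unfolding r_window_eq_Inf
proof (rule cInf_lower)
  show "P s v \<in> {P s v | v. v \<in> pair_pasts \<and> windows k v = windows k w}"
    using assms by blast
  show "bdd_below {P s v | v. v \<in> pair_pasts \<and> windows k v = windows k w}"
    by (rule bdd_belowI[of _ 0]) (use assms(3) nonneg in blast)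
qed

lemma r_window_greatest:
  assumes "w \<in> pair_pasts"
    and "\<And>v. v \<in> pair_pasts \<Longrightarrow> windows k v = windows k w \<Longrightarrow> c \<le> P s v"
  shows "c \<le> r_window k s w"
  unfolding r_window_eq_Inf by (rule cInf_greatest) (use assms in blast)+

lemma r_window_nonneg: "w \<in> pair_pasts \<Longrightarrow> s \<in> pair_alphabet \<Longrightarrow> 0 \<le> r_window k s w"
  by (intro r_window_greatest nonneg)

text \<open>A longer window leaves fewer competing pasts in the infimum.\<close>

lemma r_window_mono:
  assumes "w \<in> pair_pasts" "s \<in> pair_alphabet" "k \<le> m"
  shows "r_window k s w \<le> r_window m s w"
proof (rule r_window_greatest[OF assms(1)])
  fix v assume v: "v \<in> pair_pasts" "windows m v = windows m w"
  have "windows k v = windows k w"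
    using v(2) assms(3) by (metis windows_windows)
  then show "r_window k s w \<le> P s v"
    using v(1) assms(2) r_window_le by blast
qed

lemma r_zero_eq_r_window: "r_zero P s = r_window 0 s w"
proof -
  have "windows 0 v = windows 0 w" for v
    by (rule windows_0)
  then show ?thesis by (simp add: r_zero_def r_window_eq_Inf)
qed

text \<open>This removes the case distinction on k. At k = 0 the infimum is that of a constant over
  a nonempty set; at k \<ge> 1 every string is the window of some past.\<close>

lemma alpha_eq_Inf:
  "alpha P k = (INF w\<in>pair_pasts. \<Sum>s\<in>pair_alphabet. r_window k s w)"
proof (cases "k = 0")
  case True
  have "r_window 0 s w = r_zero P s" for s w
    by (rule r_zero_eq_r_window[symmetric])
  then show ?thesis
    using True pair_pasts_nonempty by (simp add: alpha_def)
next
  case False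
  have "pair_strings k = windows k ` pair_pasts"
    using windows_in_pair_strings by (blast elim: pair_string_extends)
  then have "{\<Sum>s\<in>pair_alphabet. r_string P k s w | w. w \<in> pair_strings k}
      = (\<lambda>w. \<Sum>s\<in>pair_alphabet. r_window k s w) ` pair_pasts"
    by (simp only: r_window_def Setcompr_eq_image image_image)
  then show ?thesis using False by (simp add: alpha_def)
qed

lemma alpha_le: "w \<in> pair_pasts \<Longrightarrow> alpha P k \<le> (\<Sum>s\<in>pair_alphabet. r_window k s w)"
  unfolding alpha_eq_Inf
  by (rule cINF_lower) (auto intro!: bdd_belowI2[of _ 0] sum_nonneg r_window_nonneg)

lemma alpha_greatest:
  "(\<And>w. w \<in> pair_pasts \<Longrightarrow> c \<le> (\<Sum>s\<in>pair_alphabet. r_window k s w)) \<Longrightarrow> c \<le> alpha P k"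
  unfolding alpha_eq_Inf by (rule cINF_greatest[OF pair_pasts_nonempty])

lemma alpha_mono: "k \<le> m \<Longrightarrow> alpha P k \<le> alpha P m"
  by (rule alpha_greatest) (blast intro: order_trans[OF alpha_le] sum_mono r_window_mono)

lemma alpha_nonneg: "0 \<le> alpha P k"
  by (intro alpha_greatest sum_nonneg r_window_nonneg)

lemma alpha_le_1: "alpha P k \<le> 1"
proof -
  obtain w where w: "w \<in> pair_pasts" using pair_pasts_nonempty by blast
  have "alpha P k \<le> (\<Sum>s\<in>pair_alphabet. r_window k s w)" by (rule alpha_le[OF w])
  also have "\<dots> \<le> (\<Sum>s\<in>pair_alphabet. P s w)"
    by (intro sum_mono r_window_le w refl)
  also have "\<dots> = 1" using prob[OF w] by (simp add: prob_vector_def)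
  finally show ?thesis .
qed

section \<open>Recursive construction of the masses and transition probabilities\<close>

lemma weight_Suc: "weight P (Suc k) = alpha P (Suc k) - alpha P k"
  by (simp add: weight_def)

text \<open>
  The step is taken towards \<open>r_{k+1}\<close>; the point mass only serves where the total of \<open>r_{k+1}\<close> is
  \<open>\<alpha>_k\<close>, so that \<open>\<lambda>_{k+1} = 0\<close>.
\<close>

definition direction ::
    "(nat \<times> nat \<Rightarrow> real) \<Rightarrow> nat \<Rightarrow> nat \<times> nat \<Rightarrow> (int \<Rightarrow> nat) \<times> (int \<Rightarrow> nat) \<Rightarrow> real" where
  "direction f k s w =
     (if (\<Sum>t\<in>pair_alphabet. r_window (Suc k) t w) = alpha P k then of_bool (s = (0, 0))
      else (r_window (Suc k) s w - f s)
        / ((\<Sum>t\<in>pair_alphabet. r_window (Suc k) t w) - alpha P k))"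

primrec mass :: "nat \<Rightarrow> (int \<Rightarrow> nat) \<times> (int \<Rightarrow> nat) \<Rightarrow> nat \<times> nat \<Rightarrow> real" where
  "mass 0 w = (\<lambda>s. r_window 0 s w)"
| "mass (Suc k) w = (\<lambda>s. mass k w s + weight P (Suc k) * direction (mass k w) k s w)"

text \<open>If \<alpha>_0 = 0, then \<lambda>_0 = 0 and any probability vector would do; the point
  mass is one choice.\<close>

definition initial :: "nat \<times> nat \<Rightarrow> real" where
  "initial s = (if alpha P 0 = 0 then of_bool (s = (0, 0)) else r_zero P s / alpha P 0)"

definition transition :: "nat \<Rightarrow> nat \<times> nat \<Rightarrow> (int \<Rightarrow> nat) \<times> (int \<Rightarrow> nat) \<Rightarrow> real" where
  "transition k s w = direction (mass (k - 1) w) (k - 1) s w"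

lemma direction_windows:
  "Suc k \<le> m \<Longrightarrow> direction f k s (windows m w) = direction f k s w"
  by (simp add: direction_def r_window_windows)

text \<open>F_k is built from r_0, ..., r_k only, so it reads just the last k symbols. Hence P_k can
  be regarded as a kernel on strings of length k.\<close>

lemma mass_windows: "k \<le> m \<Longrightarrow> mass k (windows m w) = mass k w"
  by (induction k) (simp_all add: r_window_windows direction_windows)

text \<open>The step into level k reads r at level \<open>Suc (k - 1)\<close>, which is k only for k
  \<ge> 1; at k = 0 truncated subtraction would make it read a window of length 1.\<close>

lemma transition_windows: "1 \<le> k \<Longrightarrow> transition k s (windows k w) = transition k s w"
  by (simp add: transition_def mass_windows direction_windows)

text \<open>Numerators are nonnegative because f \<le> r_k \<le> r_{k+1}. They add up to the
  denominator because f has total \<alpha>_k.\<close>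

lemma prob_direction:
  assumes w: "w \<in> pair_pasts"
    and f: "\<And>s. s \<in> pair_alphabet \<Longrightarrow> f s \<le> r_window k s w"
    and total: "(\<Sum>s\<in>pair_alphabet. f s) = alpha P k"
  shows "prob_vector pair_alphabet (\<lambda>s. direction f k s w)"
proof (rule prob_vector_pair_alphabetI)
  let ?R = "\<Sum>t\<in>pair_alphabet. r_window (Suc k) t w"
  have le: "alpha P k \<le> ?R"
    using alpha_le[OF w, of "Suc k"] alpha_mono[of k "Suc k"] by simp
  show "0 \<le> direction f k s w" if s: "s \<in> pair_alphabet" for s
  proof -
    have "f s \<le> r_window (Suc k) s w"
      using f[OF s] r_window_mono[OF w s, of k "Suc k"] by simp
    then show ?thesis using le by (simp add: direction_def)
  qed
  show "(\<Sum>s\<in>pair_alphabet. direction f k s w) = 1"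
  proof (cases "?R = alpha P k")
    case True
    then show ?thesis by (simp add: direction_def sum_pair_alphabet)
  next
    case False
    then have "(\<Sum>s\<in>pair_alphabet. direction f k s w)
        = (\<Sum>s\<in>pair_alphabet. r_window (Suc k) s w - f s) / (?R - alpha P k)"
      by (simp add: direction_def sum_divide_distrib)
    then show ?thesis using False by (simp add: sum_subtractf total)
  qed
qed

text \<open>The step replaces f by f + t (r_{k+1} - f), where t is \<lambda>_{k+1} divided by the
  total of r_{k+1} - f if f has total \<alpha>_k. It does not overshoot: \<alpha>_{k+1} is at most
  the total of r_{k+1}, so t \<le> 1.\<close>

lemma step_le:
  assumes w: "w \<in> pair_pasts" and s: "s \<in> pair_alphabet" and f: "f s \<le> r_window k s w"
  shows "f s + weight P (Suc k) * direction f k s w \<le> r_window (Suc k) s w"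
proof -
  let ?R = "\<Sum>t\<in>pair_alphabet. r_window (Suc k) t w"
  have le: "alpha P k \<le> alpha P (Suc k)" "alpha P (Suc k) \<le> ?R"
    using alpha_le[OF w, of "Suc k"] alpha_mono[of k "Suc k"] by simp_all
  have fs: "f s \<le> r_window (Suc k) s w"
    using f r_window_mono[OF w s, of k "Suc k"] by simp
  show ?thesis
  proof (cases "?R = alpha P k")
    case True
    \<comment> \<open>Here \<alpha>_{k+1} is squeezed between \<alpha>_k and itself, so the weight
      is 0 and the point mass adds nothing.\<close>
    then show ?thesis using le fs by (simp add: weight_Suc)
  next
    case False
    define t where "t = weight P (Suc k) / (?R - alpha P k)"
    have t: "t \<le> 1" using le False by (simp add: t_def weight_Suc)
    have "weight P (Suc k) * direction f k s w = t * (r_window (Suc k) s w - f s)"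
      using False by (simp add: direction_def t_def)
    also have "\<dots> \<le> r_window (Suc k) s w - f s"
      using mult_right_mono[OF t, of "r_window (Suc k) s w - f s"] fs by simp
    finally show ?thesis by simp
  qed
qed

text \<open>Both halves go through one induction, since the direction is a probability vector only
  when the bound and the total hold at the previous level.\<close>

lemma mass_invariant:
  assumes w: "w \<in> pair_pasts"
  shows "(\<forall>s\<in>pair_alphabet. mass k w s \<le> r_window k s w) \<and> (\<Sum>s\<in>pair_alphabet. mass k w s) = alpha P k"
proof (induction k)
  case 0
  show ?case by (simp add: alpha_def r_zero_eq_r_window[of _ w])
next
  case (Suc k)
  have "(\<Sum>s\<in>pair_alphabet. direction (mass k w) k s w) = 1"
    using prob_direction[OF w, of "mass k w" k] Suc by (simp add: prob_vector_def)
  then show ?case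
    using Suc step_le[OF w, of _ "mass k w" k]
    by (simp add: sum.distrib weight_Suc flip: sum_distrib_left)
qed

lemma prob_transition:
  assumes "1 \<le> k"
  shows "pair_transition_probability k (transition k)"
  unfolding pair_transition_probability_def
proof
  fix w assume "w \<in> pair_strings k"
  then obtain v where v: "v \<in> pair_pasts" "windows k v = w"
    by (rule pair_string_extends)
  \<comment> \<open>The invariant speaks of pasts, so the claim is shown at an extension of the
    string and carried back by \<open>transition_windows\<close>.\<close>
  have "prob_vector pair_alphabet (\<lambda>s. transition k s v)"
    unfolding transition_def using mass_invariant[OF v(1)] by (intro prob_direction v(1)) auto
  then show "prob_vector pair_alphabet (\<lambda>s. transition k s w)"
    using transition_windows[OF assms] by (simp flip: v(2))
qed

section \<open>The initial measure\<close>

lemma r_zero_nonneg: "s \<in> pair_alphabet \<Longrightarrow> 0 \<le> r_zero P s"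
  by (metis all_not_in_conv pair_pasts_nonempty r_window_nonneg r_zero_eq_r_window)

lemma alpha_0: "alpha P 0 = (\<Sum>s\<in>pair_alphabet. r_zero P s)"
  by (simp add: alpha_def)

lemma prob_initial: "prob_vector pair_alphabet initial"
proof (rule prob_vector_pair_alphabetI)
  show "0 \<le> initial s" if "s \<in> pair_alphabet" for s
    using r_zero_nonneg[OF that] alpha_nonneg[of 0] by (simp add: initial_def)
  show "(\<Sum>s\<in>pair_alphabet. initial s) = 1"
  proof (cases "alpha P 0 = 0")
    case True
    then show ?thesis by (simp add: initial_def sum_pair_alphabet)
  next
    case False
    then have "(\<Sum>s\<in>pair_alphabet. initial s) = (\<Sum>s\<in>pair_alphabet. r_zero P s) / alpha P 0"
      by (simp add: initial_def sum_divide_distrib)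
    then show ?thesis using False by (simp add: alpha_0)
  qed
qed

text \<open>If \<alpha>_0 = 0, the nonnegative summands of \<alpha>_0 all vanish, so both sides are
  0.\<close>

lemma weight_initial: "s \<in> pair_alphabet \<Longrightarrow> weight P 0 * initial s = r_zero P s"
  using r_zero_nonneg by (auto simp: weight_def initial_def alpha_0 sum_nonneg_eq_0_iff)

section \<open>Telescoping and convergence to the kernel\<close>

lemma mass_eq_sum:
  "s \<in> pair_alphabet \<Longrightarrow>
   mass k w s = weight P 0 * initial s + (\<Sum>j<k. weight P (Suc j) * transition (Suc j) s w)"
  by (induction k) (simp_all add: weight_initial r_zero_eq_r_window[of _ w] transition_def)

lemma mass_tendsto:
  assumes alpha: "alpha P \<longlonglongrightarrow> 1" and w: "w \<in> pair_pasts" and s: "s \<in> pair_alphabet"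
  shows "(\<lambda>k. mass k w s) \<longlonglongrightarrow> P s w"
proof -
  have le: "mass k w t \<le> P t w" if "t \<in> pair_alphabet" for k t
    using mass_invariant[OF w, of k] r_window_le[OF w refl that, of k] that by fastforce
  have "P s w - mass k w s \<le> 1 - alpha P k" for k
  proof -
    \<comment> \<open>No defect is negative, so the defect at one symbol is at most the total
      defect.\<close>
    have "P s w - mass k w s \<le> (\<Sum>t\<in>pair_alphabet. P t w - mass k w t)"
      using le by (intro member_le_sum s) auto
    also have "\<dots> = 1 - alpha P k"
      using prob[OF w] mass_invariant[OF w, of k] by (simp add: sum_subtractf prob_vector_def)
    finally show ?thesis .
  qed
  then have lower: "P s w - (1 - alpha P k) \<le> mass k w s" for k
    by (simp add: algebra_simps)
  have "(\<lambda>k. P s w - (1 - alpha P k)) \<longlonglongrightarrow> P s w - (1 - 1)"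
    by (intro tendsto_intros alpha)
  then have "(\<lambda>k. P s w - (1 - alpha P k)) \<longlonglongrightarrow> P s w" by simp
  then show ?thesis
    by (rule tendsto_sandwich[rotated 2, OF _ tendsto_const]) (use lower le[OF s] in auto)
qed

lemma decomposition:
  assumes "alpha P \<longlonglongrightarrow> 1" "w \<in> pair_pasts" "s \<in> pair_alphabet"
  shows "(\<lambda>j. weight P (Suc j) * transition (Suc j) s (windows (Suc j) w))
           sums (P s w - weight P 0 * initial s)"
proof -
  have "(\<lambda>k. mass k w s - weight P 0 * initial s) \<longlonglongrightarrow> P s w - weight P 0 * initial s"
    by (intro tendsto_intros mass_tendsto assms)
  then show ?thesis
    by (simp add: sums_def transition_windows mass_eq_sum[OF assms(3)])
qed

end

section \<open>Continuity and the coupled kernel\<close>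

lemma diff_le_beta:
  assumes p: "\<And>x. x \<in> pasts \<Longrightarrow> prob_vector alphabet (\<lambda>a. p a x)"
    and xy: "x \<in> pasts" "y \<in> pasts" "window k x = window k y" and a: "a \<in> alphabet"
  shows "\<bar>p a x - p a y\<bar> \<le> beta p k"
proof -
  let ?D = "\<lambda>a. {\<bar>p a x - p a y\<bar> | x y. x \<in> pasts \<and> y \<in> pasts \<and> window k x = window k y}"
  have bound: "0 \<le> p a z \<and> p a z \<le> 1" if "z \<in> pasts" for z
    using p[OF that] a by (simp add: prob_vector_def)
  \<comment> \<open>\<open>Sup\<close> is known to dominate a set only if the set is bounded above;
    two numbers in [0, 1] differ by at most 1.\<close>
  have "d \<le> 1" if d: "d \<in> ?D a" for d
  proof -
    from d obtain u v where "d = \<bar>p a u - p a v\<bar>" "u \<in> pasts" "v \<in> pasts" by blast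
    then show ?thesis using bound[of u] bound[of v] by linarith
  qed
  then have "bdd_above (?D a)"
    by (rule bdd_aboveI)
  then have "\<bar>p a x - p a y\<bar> \<le> Sup (?D a)"
    using xy by (intro cSup_upper) auto
  also have "\<dots> \<le> beta p k"
    unfolding beta_def using a by (intro Max_ge) (auto simp: alphabet_def)
  finally show ?thesis .
qed

lemma prob_vector_alphabet:
  assumes "prob_vector alphabet q"
  shows "0 \<le> q 0" "0 \<le> q 1" "q 0 + q 1 = 1"
  using assms by (auto simp: prob_vector_def alphabet_def)

lemma pair_pasts_past_le: "(x, y) \<in> pair_pasts \<Longrightarrow> past_le x y"
  by (fastforce simp: pair_pasts_def past_le_def pair_alphabet_def)

text \<open>The ordering is what makes the mass of (0, 1) nonnegative: it equals
  \<open>pY 1 y - pX 1 x\<close>.\<close>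

lemma coupled_kernel_prob_vector:
  assumes pX: "\<And>x. x \<in> pasts \<Longrightarrow> prob_vector alphabet (\<lambda>a. pX a x)"
    and pY: "\<And>x. x \<in> pasts \<Longrightarrow> prob_vector alphabet (\<lambda>a. pY a x)"
    and ordering: "\<And>x y. x \<in> pasts \<Longrightarrow> y \<in> pasts \<Longrightarrow> past_le x y \<Longrightarrow> pX 1 x \<le> pY 1 y"
    and w: "w \<in> pair_pasts"
  shows "prob_vector pair_alphabet (\<lambda>s. coupled_kernel pX pY s w)"
proof -
  obtain x y where xy: "w = (x, y)" "x \<in> pasts" "y \<in> pasts"
    using w by (auto simp: pair_pasts_def)
  have "pX 1 x \<le> pY 1 y"
    using ordering xy w pair_pasts_past_le by blast
  then show ?thesis
    using prob_vector_alphabet[OF pX[OF xy(2)]] prob_vector_alphabet[OF pY[OF xy(3)]]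
    by (intro prob_vector_pair_alphabetI)
      (auto simp: xy(1) sum_pair_alphabet coupled_kernel_def pair_alphabet_def)
qed

lemma alpha_coupled_kernel_tendsto:
  assumes pX: "\<And>x. x \<in> pasts \<Longrightarrow> prob_vector alphabet (\<lambda>a. pX a x)"
    and pY: "\<And>x. x \<in> pasts \<Longrightarrow> prob_vector alphabet (\<lambda>a. pY a x)"
    and ordering: "\<And>x y. x \<in> pasts \<Longrightarrow> y \<in> pasts \<Longrightarrow> past_le x y \<Longrightarrow> pX 1 x \<le> pY 1 y"
    and continuity: "(\<lambda>k. max (beta pX k) (beta pY k)) \<longlonglongrightarrow> 0"
  shows "alpha (coupled_kernel pX pY) \<longlonglongrightarrow> 1"
proof -
  let ?P = "coupled_kernel pX pY"
  interpret pair_kernel ?P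
    by unfold_locales (rule coupled_kernel_prob_vector[OF pX pY ordering])
  define b where "b k = max (beta pX k) (beta pY k)" for k
  \<comment> \<open>The mass of (0, 1) is a difference of two kernel values and so moves by at most
    2 b_k within a window; this bound also serves the other two symbols, and three symbols give 6
    b_k.\<close>
  have lower: "1 - 6 * b k \<le> alpha ?P k" for k
  proof (rule alpha_greatest)
    fix w assume w: "w \<in> pair_pasts"
    have "?P s w - 2 * b k \<le> r_window k s w" if s: "s \<in> pair_alphabet" for s
    proof (rule r_window_greatest[OF w])
      fix v assume v: "v \<in> pair_pasts" "windows k v = windows k w"
      obtain x y x' y' where eqs: "w = (x, y)" "v = (x', y')" by (cases w; cases v)
      have xs: "x \<in> pasts" "x' \<in> pasts" "window k x = window k x'"
        and ys: "y \<in> pasts" "y' \<in> pasts" "window k y = window k y'"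
        using w v by (auto simp: eqs pair_pasts_def windows_def)
      have "\<bar>pX a x - pX a x'\<bar> \<le> b k" "\<bar>pY a y - pY a y'\<bar> \<le> b k" if "a \<in> alphabet" for a
        using diff_le_beta[of pX, OF pX xs that] diff_le_beta[of pY, OF pY ys that]
        by (auto simp: b_def)
      from this[of 0] this[of 1] show "?P s w - 2 * b k \<le> ?P s v"
        by (auto simp: eqs coupled_kernel_def alphabet_def)
    qed
    then have "(\<Sum>s\<in>pair_alphabet. ?P s w - 2 * b k) \<le> (\<Sum>s\<in>pair_alphabet. r_window k s w)"
      by (rule sum_mono)
    moreover have "(\<Sum>s\<in>pair_alphabet. ?P s w) = 1"
      using prob[OF w] by (simp add: prob_vector_def)
    ultimately show "1 - 6 * b k \<le> (\<Sum>s\<in>pair_alphabet. r_window k s w)"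
      by (simp add: sum_pair_alphabet)
  qed
  have "(\<lambda>k. 1 - 6 * b k) \<longlonglongrightarrow> 1 - 6 * 0"
    unfolding b_def by (intro tendsto_intros continuity)
  then have "(\<lambda>k. 1 - 6 * b k) \<longlonglongrightarrow> 1" by simp
  then show ?thesis
    by (rule tendsto_sandwich[rotated 2, OF _ tendsto_const]) (use lower alpha_le_1 in auto)
qed

section \<open>The decomposition of the coupled kernel\<close>

theorem theorem3:
  fixes M :: "'v measure" and N :: "'w measure"
    and X :: "int \<Rightarrow> 'v \<Rightarrow> nat" and Y :: "int \<Rightarrow> 'w \<Rightarrow> nat"
    and pX pY :: "nat \<Rightarrow> (int \<Rightarrow> nat) \<Rightarrow> real"
  assumes "chain_of_infinite_order M X pX"
    and "chain_of_infinite_order N Y pY"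
    and ordering: "\<And>x y. x \<in> pasts \<Longrightarrow> y \<in> pasts \<Longrightarrow> past_le x y \<Longrightarrow> pX 1 x \<le> pY 1 y"
    and continuity: "(\<lambda>k. max (beta pX k) (beta pY k)) \<longlonglongrightarrow> 0"
    and "convergent_prod (alpha (coupled_kernel pX pY))"
    and "(\<Prod>k. alpha (coupled_kernel pX pY) k) > 0"
  shows "\<exists>(Pk :: nat \<Rightarrow> nat \<times> nat \<Rightarrow> (int \<Rightarrow> nat) \<times> (int \<Rightarrow> nat) \<Rightarrow> real)
            (P0 :: nat \<times> nat \<Rightarrow> real).
           (\<forall>k\<ge>1. pair_transition_probability k (Pk k)) \<and>
           prob_vector pair_alphabet P0 \<and>
           (\<forall>(a, b)\<in>pair_alphabet. \<forall>(x, y)\<in>pair_pasts.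
              summable (\<lambda>j. weight (coupled_kernel pX pY) (Suc j)
                             * Pk (Suc j) (a, b) (window (Suc j) x, window (Suc j) y)) \<and>
              coupled_kernel pX pY (a, b) (x, y) =
                weight (coupled_kernel pX pY) 0 * P0 (a, b)
                + (\<Sum>j. weight (coupled_kernel pX pY) (Suc j)
                         * Pk (Suc j) (a, b) (window (Suc j) x, window (Suc j) y)))"
proof -
  let ?P = "coupled_kernel pX pY"
  have pX: "prob_vector alphabet (\<lambda>a. pX a x)" and pY: "prob_vector alphabet (\<lambda>a. pY a x)"
    if "x \<in> pasts" for x
    using assms(1,2) that by (auto simp: chain_of_infinite_order_def)
  interpret pair_kernel ?P
    by unfold_locales (rule coupled_kernel_prob_vector[OF pX pY ordering])
  have alpha: "alpha ?P \<longlonglongrightarrow> 1"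
    by (rule alpha_coupled_kernel_tendsto[OF pX pY ordering continuity])
  show ?thesis
  proof (intro exI conjI)
    show "\<forall>k\<ge>1. pair_transition_probability k (transition k)"
      using prob_transition by blast
    show "prob_vector pair_alphabet initial"
      by (rule prob_initial)
    show "\<forall>(a, b)\<in>pair_alphabet. \<forall>(x, y)\<in>pair_pasts.
        summable (\<lambda>j. weight ?P (Suc j)
          * transition (Suc j) (a, b) (window (Suc j) x, window (Suc j) y)) \<and>
        ?P (a, b) (x, y) = weight ?P 0 * initial (a, b)
          + (\<Sum>j. weight ?P (Suc j)
              * transition (Suc j) (a, b) (window (Suc j) x, window (Suc j) y))"
    proof clarify
      fix a b x y assume ab: "(a, b) \<in> pair_alphabet" and xy: "(x, y) \<in> pair_pasts"
      \<comment> \<open>One \<open>sums\<close> statement yields both summability and the value of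
        the series.\<close>
      have "(\<lambda>j. weight ?P (Suc j)
            * transition (Suc j) (a, b) (window (Suc j) x, window (Suc j) y))
          sums (?P (a, b) (x, y) - weight ?P 0 * initial (a, b))"
        using decomposition[OF alpha xy ab] by (simp add: windows_def)
      then show "summable (\<lambda>j. weight ?P (Suc j)
            * transition (Suc j) (a, b) (window (Suc j) x, window (Suc j) y)) \<and>
          ?P (a, b) (x, y) = weight ?P 0 * initial (a, b)
            + (\<Sum>j. weight ?P (Suc j)
                * transition (Suc j) (a, b) (window (Suc j) x, window (Suc j) y))"
        by (simp add: sums_iff)
    qed
  qed
qed

end
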